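(* Let $K$ be a quadratic field with discriminant $\Delta_K$, let $d=|\Delta_K|$, and let $\chi$ be the Dirichlet character attached to $K/\mathbb{Q}$. Let $p_1$ and $p_2$ be given, for $\mathrm{Re}(s)>1$, by $$p_1(s)=\prod_{\chi(p)=1}(1-p^{-s})^{-1},\qquad p_2(s)=\prod_{\chi(p)=-1}(1-p^{-s})^{-1}.$$ Then $$p_i(s)=\exp\left\{-\frac{1}{2}\sum_{n\ge0}\frac{\log q_i(2^ns)}{2^n}\right\}\qquad\text{for } i=1,2,$$ where $$q_1(s)=\frac{\zeta(2s)}{\zeta(s)L(s,\chi)}\prod_{p\mid d}(1+p^{-s}),\qquad q_2(s)=\frac{L(s,\chi)}{\zeta(s)}\prod_{p\mid d}(1-p^{-s})^{-1}.$$
   Context: The identity is considered for $\mathrm{Re}(s)>1$, and $\log$ denotes the principal branch of the complex logarithm. The Dirichlet character attached to the quadratic field $K$ is the primitive quadratic character modulo $d=|\Delta_K|$ given by the Kronecker symbol $\chi(n)=\left(\frac{\Delta_K}{n}\right)$; for a prime $p$, $\chi(p)=1,-1,0$ according as $p$ splits, is inert, or ramifies in $K$. $\zeta$ is the Riemann zeta function and $L(s,\chi)$ is the Dirichlet $L$-function of $\chi$. All products are over prime numbers $p$ satisfying the indicated condition.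
   Formalization: With the principal log the identity fails by a sign at some s with 1<Re(s)<2; here log q_i is the holomorphic branch on Re(s)>1 that is principal for real s>1, and the principal-log form is claimed where the two agree, including real s>1 and Re(s)≥2. *)

theory Defs
  imports "HOL-Analysis.Analysis" "HOL-Number_Theory.Number_Theory"
begin

text \<open>Every quadratic field embeds in the complex numbers, so number fields are represented as
  subfields of \<open>\<complex>\<close>.\<close>

definition complex_subfield :: "complex set \<Rightarrow> bool" where
  "complex_subfield K \<longleftrightarrow> 0 \<in> K \<and> 1 \<in> K \<and>
     (\<forall>x\<in>K. \<forall>y\<in>K. x + y \<in> K \<and> x * y \<in> K) \<and> (\<forall>x\<in>K. - x \<in> K \<and> inverse x \<in> K)"

definition quadratic_field :: "complex set \<Rightarrow> bool" where
  "quadratic_field K \<longleftrightarrow> complex_subfield K \<and>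
     vector_space.dim (\<lambda>(q::rat) (x::complex). of_rat q * x) K = 2"

definition ring_of_integers :: "complex set \<Rightarrow> complex set" where
  "ring_of_integers K = {x \<in> K. algebraic_int x}"

definition integral_basis2 :: "complex set \<Rightarrow> complex \<Rightarrow> complex \<Rightarrow> bool" where
  "integral_basis2 K w1 w2 \<longleftrightarrow> w1 \<in> ring_of_integers K \<and> w2 \<in> ring_of_integers K \<and>
     (\<forall>x\<in>ring_of_integers K. \<exists>!c :: int \<times> int. x = of_int (fst c) * w1 + of_int (snd c) * w2)"

text \<open>Only the values on \<open>K\<close> of an embedding are relevant.\<close>

definition field_embedding :: "complex set \<Rightarrow> (complex \<Rightarrow> complex) \<Rightarrow> bool" where
  "field_embedding K \<sigma> \<longleftrightarrow> \<sigma> 1 = 1 \<and>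
     (\<forall>x\<in>K. \<forall>y\<in>K. \<sigma> (x + y) = \<sigma> x + \<sigma> y \<and> \<sigma> (x * y) = \<sigma> x * \<sigma> y)"

text \<open>\<open>\<Delta>\<close> is the square of the determinant of the matrix \<open>(\<sigma>\<^sub>i w\<^sub>j)\<close>, where \<open>w\<^sub>1, w\<^sub>2\<close> is an integral
  basis of \<open>K\<close> and \<open>\<sigma>\<^sub>1, \<sigma>\<^sub>2\<close> are the two complex embeddings. The discriminant is given as a
  relation; the value does not depend on the choices.\<close>

definition has_discriminant :: "complex set \<Rightarrow> int \<Rightarrow> bool" where
  "has_discriminant K \<Delta> \<longleftrightarrow> (\<exists>w1 w2 \<sigma>1 \<sigma>2. integral_basis2 K w1 w2 \<and>
     field_embedding K \<sigma>1 \<and> field_embedding K \<sigma>2 \<and> (\<exists>x\<in>K. \<sigma>1 x \<noteq> \<sigma>2 x) \<and>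
     of_int \<Delta> = (\<sigma>1 w1 * \<sigma>2 w2 - \<sigma>1 w2 * \<sigma>2 w1)\<^sup>2)"

definition kronecker_prime :: "int \<Rightarrow> nat \<Rightarrow> int" where
  "kronecker_prime a p =
     (if p = 2 then (if even a then 0 else if a mod 8 \<in> {1, 7} then 1 else - 1)
      else Legendre a (int p))"

definition kronecker :: "int \<Rightarrow> nat \<Rightarrow> int" where
  "kronecker a n =
     (if n = 0 then (if \<bar>a\<bar> = 1 then 1 else 0)
      else (\<Prod>p\<in>#prime_factorization n. kronecker_prime a p))"

text \<open>The Dirichlet series below represent \<open>\<zeta>\<close> and \<open>L\<close> only on the half-plane \<open>Re s > 1\<close>, which is
  the only region where they are used.\<close>

definition zeta :: "complex \<Rightarrow> complex" where
  "zeta s = (\<Sum>n. of_nat (Suc n) powr (- s))"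

definition dirichlet_L :: "(nat \<Rightarrow> int) \<Rightarrow> complex \<Rightarrow> complex" where
  "dirichlet_L chi s = (\<Sum>n. of_int (chi (Suc n)) * of_nat (Suc n) powr (- s))"

definition prime_product :: "(nat \<Rightarrow> bool) \<Rightarrow> (nat \<Rightarrow> complex) \<Rightarrow> complex" where
  "prime_product P f = prodinf (\<lambda>n. if prime n \<and> P n then f n else 1)"

text \<open>\<open>l\<close> is the branch of \<open>log f\<close> on \<open>Re s > 1\<close> obtained by analytic continuation of the
  principal logarithm from the real ray \<open>s > 1\<close>; it is unique on this half-plane. It can differ
  from \<open>Ln (f s)\<close> by a multiple of \<open>2 \<pi> \<i>\<close> at points \<open>s\<close> where \<open>f\<close> has wound across the negative
  real axis.\<close>

definition log_branch :: "(complex \<Rightarrow> complex) \<Rightarrow> (complex \<Rightarrow> complex) \<Rightarrow> bool" where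
  "log_branch f l \<longleftrightarrow> l holomorphic_on {s. Re s > 1} \<and> (\<forall>s. Re s > 1 \<longrightarrow> exp (l s) = f s) \<and>
     (\<forall>x::real. x > 1 \<longrightarrow> l (of_real x) = Ln (f (of_real x)))"

end

theory Submission
  imports Defs "HOL-Complex_Analysis.Complex_Analysis"
begin

text \<open>
  Comparing Euler factors, \<open>q\<^sub>i(s)\<close> is the product of \<open>(1 - p\<^sup>-\<^sup>s) / (1 + p\<^sup>-\<^sup>s)\<close> over the primes that occur
  in \<open>p\<^sub>i\<close>. Put \<open>A(s) = \<Sum> log (1 - p\<^sup>-\<^sup>s)\<close> over these primes, so that \<open>p\<^sub>i = exp (-A)\<close>. Since
  \<open>log (1 - z\<^sup>2) = log (1 - z) + log (1 + z)\<close> for \<open>|z| < 1\<close>, the function \<open>l(s) = 2 A(s) - A(2 s)\<close>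
  is a holomorphic logarithm of \<open>q\<^sub>i\<close>, real on the real ray, and \<open>\<Sum> l(2\<^sup>n s) / 2\<^sup>n\<close> telescopes to
  \<open>2 A(s)\<close> because \<open>A\<close> is bounded on every \<open>Re s \<ge> x > 1\<close>. For \<open>Re s \<ge> 2\<close> the branch is principal,
  as \<open>|l(s)| \<le> 4 (\<zeta>(2) - 1) < \<pi>\<close>.

  The Euler products of \<open>\<zeta>\<close> and \<open>L\<close> are obtained by sieving. The quadratic field enters through
  \<open>\<Delta> \<noteq> 0\<close>, which makes the product over \<open>p | d\<close> finite.
\<close>

section \<open>Nonvanishing of the discriminant of a quadratic field\<close>

text \<open>In a rational space of dimension 2 the vectors \<open>1\<close>, \<open>x\<close>,
  \<open>x\<^sup>2\<close> are dependent, and for irrational \<open>x\<close> the coefficient of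
  \<open>x\<^sup>2\<close> in a relation cannot vanish.\<close>

lemma quadratic_field_relation:
  assumes "quadratic_field K" and "x \<in> K"
  obtains b c :: rat where "x\<^sup>2 = of_rat b * x + of_rat c"
proof (cases "x \<in> \<rat>")
  case True
  then obtain r where "x = of_rat r" by (auto elim: Rats_cases)
  then have "x\<^sup>2 = of_rat r * x + of_rat 0" by (simp add: power2_eq_square)
  then show ?thesis by (rule that)
next
  case False
  interpret vector_space "\<lambda>(q::rat) (x::complex). of_rat q * x"
    by unfold_locales (auto simp: algebra_simps of_rat_add of_rat_mult)
  have K: "1 \<in> K" "x\<^sup>2 \<in> K"
    using assms by (auto simp: quadratic_field_def complex_subfield_def power2_eq_square)
  obtain B where B: "B \<subseteq> K" "independent B" "K \<subseteq> span B" "card B = dim K"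
    using basis_exists .
  have "card B = 2" using B assms by (simp add: quadratic_field_def)
  \<comment> \<open>An infinite set has \<open>card\<close> 0, so \<open>card B = 2\<close> already
    gives finiteness.\<close>
  then have "finite B" by (metis card.infinite zero_neq_numeral)
  \<comment> \<open>Two of \<open>1\<close>, \<open>x\<close>, \<open>x\<^sup>2\<close> coincide
    only at these three rational values.\<close>
  have ne: "x \<noteq> 0" "x \<noteq> 1" "x \<noteq> - 1"
    using False by auto
  then have distinct: "1 \<noteq> x" "x\<^sup>2 \<noteq> x" "x\<^sup>2 \<noteq> 1"
    by (auto simp: power2_eq_1_iff) (simp add: power2_eq_square)
  have "card {1, x, x\<^sup>2} = 3" using distinct by auto
  then have "dependent {1, x, x\<^sup>2}"
    using independent_span_bound[OF \<open>finite B\<close>, of "{1, x, x\<^sup>2}"] \<open>card B = 2\<close> B K assms(2) by auto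
  then obtain u where u: "(\<exists>v\<in>{1, x, x\<^sup>2}. u v \<noteq> 0)" "(\<Sum>v\<in>{1, x, x\<^sup>2}. of_rat (u v) * v) = 0"
    by (subst (asm) dependent_finite) auto
  have eq: "of_rat (u 1) + of_rat (u x) * x + of_rat (u (x\<^sup>2)) * x\<^sup>2 = 0"
    using u(2) distinct by (auto simp: add.assoc)
  have "u (x\<^sup>2) \<noteq> 0"
  proof
    assume 0: "u (x\<^sup>2) = 0"
    show False
    proof (cases "u x = 0")
      case True
      with 0 eq u(1) show False by auto
    next
      case False
      then have "x = of_rat (- u 1 / u x)"
        using eq 0 by (simp add: of_rat_divide of_rat_minus field_simps eq_neg_iff_add_eq_0)
      with \<open>x \<notin> \<rat>\<close> show False by (metis Rats_of_rat)
    qed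
  qed
  then have "x\<^sup>2 = of_rat (- u x / u (x\<^sup>2)) * x + of_rat (- u 1 / u (x\<^sup>2))"
    using eq by (simp add: of_rat_divide of_rat_minus field_simps) 
      (metis add.commute add_eq_0_iff minus_add_distrib mult.commute)
  then show ?thesis by (rule that)
qed

text \<open>Clearing denominators in the quadratic relation makes a multiple of \<open>x\<close> a
  root of a monic integer polynomial.\<close>

lemma quadratic_field_integer_multiple:
  assumes "quadratic_field K" and "x \<in> K"
  obtains n :: int where "n \<noteq> 0" and "algebraic_int (of_int n * x)"
proof -
  obtain b c where rel: "x\<^sup>2 = of_rat b * x + of_rat c"
    using quadratic_field_relation[OF assms] .
  obtain b1 b2 c1 c2 where q: "quotient_of b = (b1, b2)" "quotient_of c = (c1, c2)"
    by fastforce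
  have pos: "b2 \<noteq> 0" "c2 \<noteq> 0" using q quotient_of_denom_pos by force+
  have b: "of_rat b = (of_int b1 / of_int b2 :: complex)"
    and c: "of_rat c = (of_int c1 / of_int c2 :: complex)"
    using q quotient_of_div[of b] quotient_of_div[of c] by (simp_all add: of_rat_divide)
  \<comment> \<open>With \<open>y = b2 * c2 * x\<close>, multiplying the relation by
    \<open>(b2 * c2)\<^sup>2\<close> gives
    \<open>y\<^sup>2 = b1 * c2 * y + c1 * b2\<^sup>2 * c2\<close>.\<close>
  let ?P = "[: - (c1 * b2\<^sup>2 * c2), - (b1 * c2), 1 :]"
  have "of_int b2 * of_int c2 * x\<^sup>2 = of_int b2 * of_int c1 + of_int b1 * of_int c2 * x"
    using rel pos unfolding b c by (simp add: field_simps)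
  then have "(of_int b2 * of_int c2) * (of_int b2 * of_int c2 * x\<^sup>2) =
      (of_int b2 * of_int c2) * (of_int b2 * of_int c1 + of_int b1 * of_int c2 * x)" by simp
  then have "poly (map_poly of_int ?P) (of_int (b2 * c2) * x) = 0"
    by (simp add: map_poly_pCons algebra_simps power2_eq_square)
  then have "algebraic_int (of_int (b2 * c2) * x)"
    unfolding algebraic_int_altdef_ipoly by (intro exI[of _ ?P]) simp
  then show ?thesis using that[of "b2 * c2"] pos by simp
qed

lemma complex_subfield_of_int:
  assumes "complex_subfield K"
  shows "of_int n \<in> K"
  by (induction n rule: int_induct[of _ 0])
    (use assms in \<open>auto simp: complex_subfield_def diff_conv_add_uminus
       simp del: add_uminus_conv_diff\<close>)

lemma field_embedding_of_int_mult:
  assumes "field_embedding K \<sigma>" and "complex_subfield K" and "x \<in> K"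
  shows "\<sigma> (of_int n * x) = of_int n * \<sigma> x"
proof -
  have closed: "u + v \<in> K" "u * v \<in> K" "- u \<in> K" "0 \<in> K" "1 \<in> K" if "u \<in> K" "v \<in> K" for u v
    using assms(2) that by (auto simp: complex_subfield_def)
  have add: "\<sigma> (u + v) = \<sigma> u + \<sigma> v" if "u \<in> K" "v \<in> K" for u v
    using assms(1) that by (auto simp: field_embedding_def)
  have zero: "\<sigma> 0 = 0" using add[of 0 0] closed[OF assms(3,3)] by simp
  have nat: "of_nat k * x \<in> K \<and> \<sigma> (of_nat k * x) = of_nat k * \<sigma> x" for k
    by (induction k) (use zero assms(3) in \<open>auto simp: distrib_right add closed intro: closed\<close>)
  show ?thesis
  proof (cases n)
    case (nonneg k)
    then show ?thesis using nat[of k] by simp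
  next
    case (neg k)
    let ?y = "of_nat (Suc k) * x"
    have "\<sigma> ?y + \<sigma> (- ?y) = 0"
      using add[of ?y "- ?y"] nat[of "Suc k"] closed[of ?y ?y] zero by simp
    then have "\<sigma> (- ?y) = - \<sigma> ?y" by (rule minus_unique[symmetric])
    moreover have n: "of_int n = - (of_nat (Suc k) :: complex)" using neg by simp
    ultimately show ?thesis
      using nat[of "Suc k"] by (simp only: n mult_minus_left)
  qed
qed

text \<open>A vanishing determinant, combined with an expansion of 1 in the integral basis, makes
  the two embeddings agree on the basis and so on all integers of \<open>K\<close>. Every element of
  \<open>K\<close> has a nonzero integer multiple among these, so the embeddings would agree on
  \<open>K\<close>.\<close>

lemma discriminant_nonzero:
  assumes K: "quadratic_field K" and disc: "has_discriminant K \<Delta>"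
  shows "\<Delta> \<noteq> 0"
proof
  assume "\<Delta> = 0"
  then obtain w1 w2 \<sigma> \<tau> x where basis: "integral_basis2 K w1 w2"
    and emb: "field_embedding K \<sigma>" "field_embedding K \<tau>"
    and x: "x \<in> K" "\<sigma> x \<noteq> \<tau> x" and det: "\<sigma> w1 * \<tau> w2 = \<sigma> w2 * \<tau> w1"
    using disc by (auto simp: has_discriminant_def)
  have sub: "complex_subfield K" using K by (simp add: quadratic_field_def)
  have w: "w1 \<in> K" "w2 \<in> K" using basis by (auto simp: integral_basis2_def ring_of_integers_def)
  have lin: "\<phi> (of_int a * w1 + of_int b * w2) = of_int a * \<phi> w1 + of_int b * \<phi> w2"
    if \<phi>: "field_embedding K \<phi>" for \<phi> a b
  proof -
    have int: "of_int n * u \<in> K" if u: "u \<in> K" for n u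
      using complex_subfield_of_int[OF sub, of n] u sub by (auto simp: complex_subfield_def)
    show ?thesis
      using \<phi> int w field_embedding_of_int_mult[OF \<phi> sub] by (simp add: field_embedding_def)
  qed
  have repr: "\<exists>a b. y = of_int a * w1 + of_int b * w2" if "y \<in> ring_of_integers K" for y
    using basis that by (force simp: integral_basis2_def)
  have "1 \<in> ring_of_integers K"
    using sub by (simp add: ring_of_integers_def complex_subfield_def)
  then obtain a b where ab: "1 = of_int a * w1 + of_int b * w2" using repr by blast
  have one: "of_int a * \<phi> w1 + of_int b * \<phi> w2 = 1" if "field_embedding K \<phi>" for \<phi>
    using lin[OF that, of a b] that by (simp add: field_embedding_def flip: ab)
  \<comment> \<open>Multiply by \<open>\<tau> 1 = 1\<close>, use \<open>det\<close> to exchange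
    \<open>\<sigma> w1 * \<tau> w2\<close> for \<open>\<sigma> w2 * \<tau> w1\<close>, and recognise
    \<open>\<tau> w1\<close> times \<open>\<sigma> 1 = 1\<close>.\<close>
  have "\<sigma> w1 = \<sigma> w1 * (of_int a * \<tau> w1 + of_int b * \<tau> w2)"
    using one[OF emb(2)] by simp
  also have "\<dots> = \<tau> w1 * (of_int a * \<sigma> w1 + of_int b * \<sigma> w2)"
    using det by (simp add: algebra_simps)
  finally have w1: "\<sigma> w1 = \<tau> w1" using one[OF emb(1)] by simp
  have "\<sigma> w2 = \<sigma> w2 * (of_int a * \<tau> w1 + of_int b * \<tau> w2)"
    using one[OF emb(2)] by simp
  also have "\<dots> = \<tau> w2 * (of_int a * \<sigma> w1 + of_int b * \<sigma> w2)"
    using det by (simp add: algebra_simps)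
  finally have w2: "\<sigma> w2 = \<tau> w2" using one[OF emb(1)] by simp
  obtain n where n: "n \<noteq> 0" "algebraic_int (of_int n * x)"
    using quadratic_field_integer_multiple[OF K x(1)] .
  have "of_int n * x \<in> ring_of_integers K"
    using n x sub complex_subfield_of_int[OF sub, of n] by (auto simp: ring_of_integers_def complex_subfield_def)
  then have "\<sigma> (of_int n * x) = \<tau> (of_int n * x)"
    using repr lin[OF emb(1)] lin[OF emb(2)] w1 w2 by metis
  then show False
    using n x field_embedding_of_int_mult[OF emb(1) sub x(1)]
      field_embedding_of_int_mult[OF emb(2) sub x(1)] by simp
qed

section \<open>Euler products by sieving\<close>

text \<open>What the sieve leaves after all primes below \<open>N\<close> have been treated. The
  number 1 always survives; 0 survives exactly for \<open>N \<le> 2\<close>, since every prime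
  divides it.\<close>

definition rough_numbers :: "nat \<Rightarrow> nat set" where
  "rough_numbers N = {n. \<forall>p. prime p \<and> p dvd n \<longrightarrow> N \<le> p}"

lemma rough_numbers_Suc_not_prime:
  assumes "\<not> prime N"
  shows "rough_numbers (Suc N) = rough_numbers N"
  using assms unfolding rough_numbers_def by (metis Suc_leD Suc_leI order_le_imp_less_or_eq)

lemma rough_numbers_prime:
  assumes "prime N"
  shows "rough_numbers N = rough_numbers (Suc N) \<union> (*) N ` rough_numbers N"
proof (intro equalityI subsetI)
  fix n assume n: "n \<in> rough_numbers N"
  show "n \<in> rough_numbers (Suc N) \<union> (*) N ` rough_numbers N"
  proof (cases "N dvd n")
    case True
    then obtain m where "n = N * m" by blast
    with n show ?thesis by (auto simp: rough_numbers_def)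
  next
    case False
    with n show ?thesis
      by (auto simp: rough_numbers_def Suc_le_eq order.strict_iff_order)
  qed
next
  fix n assume "n \<in> rough_numbers (Suc N) \<union> (*) N ` rough_numbers N"
  then show "n \<in> rough_numbers N"
  proof
    assume "n \<in> rough_numbers (Suc N)"
    then show ?thesis by (auto simp: rough_numbers_def Suc_le_eq less_imp_le)
  next
    assume "n \<in> (*) N ` rough_numbers N"
    then obtain m where n: "n = N * m" and m: "m \<in> rough_numbers N" by blast
    have "N \<le> p" if p: "prime p" "p dvd n" for p
      using p m n assms primes_dvd_imp_eq[of p N] by (auto simp: prime_dvd_mult_iff rough_numbers_def)
    then show ?thesis by (simp add: rough_numbers_def)
  qed
qed

text \<open>Passing a prime \<open>N\<close> removes the multiples of \<open>N\<close>, whose sum is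
  \<open>f N\<close> times the current sum by multiplicativity. This leaves the factor
  \<open>1 - f N\<close>.\<close>

lemma infsum_rough_numbers:
  fixes f :: "nat \<Rightarrow> complex"
  assumes mult: "\<And>m n. f (m * n) = f m * f n" and summ: "summable (\<lambda>n. norm (f n))"
  shows "infsum f (rough_numbers N) = (\<Prod>n<N. if prime n then 1 - f n else 1) * suminf f"
proof (induction N)
  case 0
  have "(f has_sum suminf f) UNIV"
    by (rule norm_summable_imp_has_sum[OF summ summable_sums[OF summable_norm_cancel[OF summ]]])
  then show ?case by (simp add: rough_numbers_def infsumI)
next
  case (Suc N)
  show ?case
  proof (cases "prime N")
    case True
    have summ_on: "f summable_on A" for A
      by (rule summable_on_subset_banach[OF norm_summable_imp_summable_on[OF summ]]) auto
    have disj: "rough_numbers (Suc N) \<inter> (*) N ` rough_numbers N = {}"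
      using True by (auto simp: rough_numbers_def)
    have "infsum f (rough_numbers N) =
        infsum f (rough_numbers (Suc N)) + infsum f ((*) N ` rough_numbers N)"
      by (subst rough_numbers_prime[OF True]) (intro infsum_Un_disjoint summ_on disj)
    also have "infsum f ((*) N ` rough_numbers N) = f N * infsum f (rough_numbers N)"
      using True by (subst infsum_reindex)
        (auto simp: inj_on_def mult o_def infsum_cmult_right')
    finally have "infsum f (rough_numbers (Suc N)) = (1 - f N) * infsum f (rough_numbers N)"
      unfolding left_diff_distrib by (metis add_diff_cancel_right' mult_1)
    then show ?thesis using True Suc by simp
  qed (simp add: Suc rough_numbers_Suc_not_prime)
qed

text \<open>In the limit only the term at 1 survives the sieve; the other survivors are at least
  \<open>N\<close>, so they are bounded by a tail of the absolutely convergent series.\<close>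

lemma euler_product_sieve:
  fixes f :: "nat \<Rightarrow> complex"
  assumes mult: "\<And>m n. f (m * n) = f m * f n" and f1: "f 1 = 1"
    and summ: "summable (\<lambda>n. norm (f n))"
  shows "(\<lambda>N. (\<Prod>n<N. if prime n then 1 - f n else 1) * suminf f) \<longlonglongrightarrow> 1"
proof -
  have abs_on: "(\<lambda>n. norm (f n)) summable_on A" for A
    by (rule summable_on_subset_banach[OF norm_summable_imp_summable_on]) (use summ in auto)
  have summ_on: "f summable_on A" for A
    using abs_on by (rule abs_summable_summable)
  \<comment> \<open>\<open>N > 2\<close> removes 0 from the rough numbers, so that every survivor
    other than 1 is at least \<open>N\<close>.\<close>
  have bound: "norm (infsum f (rough_numbers N) - 1) \<le> (\<Sum>n. norm (f (n + N)))" if "N > 2" for N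
  proof -
    have one: "1 \<in> rough_numbers N" by (auto simp: rough_numbers_def)
    have ge: "n \<ge> N" if n: "n \<in> rough_numbers N - {1}" for n
    proof (cases "n = 0")
      case True
      with n have "N \<le> 2" by (auto simp: rough_numbers_def)
      with \<open>N > 2\<close> show ?thesis by simp
    next
      case False
      obtain p where "prime p" "p dvd n" using n prime_factor_nat by blast
      then have "p \<le> n" "N \<le> p" using n False by (auto simp: rough_numbers_def dvd_imp_le)
      then show ?thesis by simp
    qed
    have "infsum f (rough_numbers N) = infsum f {1} + infsum f (rough_numbers N - {1})"
      using one by (subst infsum_Un_disjoint[symmetric]) (auto intro: summ_on simp: insert_absorb)
    then have "norm (infsum f (rough_numbers N) - 1) = norm (infsum f (rough_numbers N - {1}))"
      using f1 by simp
    also have "\<dots> \<le> infsum (\<lambda>n. norm (f n)) (rough_numbers N - {1})"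
      by (rule norm_infsum_bound) (rule abs_on)
    also have "\<dots> \<le> infsum (\<lambda>n. norm (f n)) {N..}"
      by (rule infsum_mono2) (use ge abs_on in auto)
    also have "\<dots> = infsum (\<lambda>n. norm (f (n + N))) UNIV"
      by (rule infsum_reindex_bij_witness[where i = "\<lambda>n. n + N" and j = "\<lambda>n. n - N"]) auto
    also have "\<dots> = (\<Sum>n. norm (f (n + N)))"
      by (intro infsumI norm_summable_imp_has_sum summable_sums)
        (use summable_ignore_initial_segment[OF summ, of N] in simp_all)
    finally show ?thesis .
  qed
  have "(\<lambda>N. \<Sum>n. norm (f (n + N))) \<longlonglongrightarrow> 0"
    by (rule suminf_exist_split2) (use summ in simp)
  then have "(\<lambda>N. infsum f (rough_numbers N) - 1) \<longlonglongrightarrow> 0"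
    by (rule Lim_null_comparison[rotated])
      (use bound in \<open>auto intro: eventually_mono[OF eventually_gt_at_top[of 2]]\<close>)
  then show ?thesis
    by (simp add: LIM_zero_iff infsum_rough_numbers[OF mult summ])
qed

section \<open>Logarithms of Euler products\<close>

lemma norm_nat_powr_minus: "norm (of_nat n powr (- s) :: complex) = real n powr (- Re s)"
  by (cases "n = 0") (simp_all add: norm_powr_real_powr)

text \<open>Primes are at least 2 and the exponent exceeds 1. The bound 1/2 is the one under which
  \<open>norm_Ln_le\<close> gives \<open>|Ln (1 + z)| \<le> 2 |z|\<close>.\<close>

lemma norm_prime_powr_less:
  fixes c s :: complex
  assumes "prime n" and "Re s > 1" and "norm c \<le> 1"
  shows "norm (c * of_nat n powr (- s)) < 1 / 2"
proof -
  have "norm (c * of_nat n powr (- s)) \<le> real n powr (- Re s)"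
    using assms by (simp add: norm_mult norm_nat_powr_minus mult_left_le_one_le)
  also have "\<dots> \<le> 2 powr (- Re s)"
    using assms prime_ge_2_nat[of n] by (intro powr_mono2') auto
  also have "\<dots> < 2 powr (- 1)"
    using assms by (intro powr_less_mono) auto
  finally show ?thesis by (simp add: powr_minus)
qed

lemma nat_powr_minus_square: "(of_nat n powr (- s))\<^sup>2 = (of_nat n powr (- (2 * s)) :: complex)"
  by (cases "n = 0") (simp_all add: powr_def power2_eq_square mult.assoc flip: exp_add)

text \<open>The summands of \<open>A\<close>, with general coefficients: indicators of sets of
  primes give \<open>p\<^sub>i\<close>, the constant 1 gives \<open>zeta\<close>, and Kronecker
  symbols give \<open>dirichlet_L\<close>. The logarithm of the Euler product is the negative of the
  sum.\<close>

definition log_euler_term :: "(nat \<Rightarrow> complex) \<Rightarrow> complex \<Rightarrow> nat \<Rightarrow> complex" where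
  "log_euler_term c s n = (if prime n then Ln (1 - c n * of_nat n powr (- s)) else 0)"

definition log_euler :: "(nat \<Rightarrow> complex) \<Rightarrow> complex \<Rightarrow> complex" where
  "log_euler c s = (\<Sum>n. log_euler_term c s n)"

definition prime_powr :: "real \<Rightarrow> nat \<Rightarrow> real" where
  "prime_powr x n = (if prime n then real n powr (- x) else 0)"

lemma summable_prime_powr: "x > 1 \<Longrightarrow> summable (prime_powr x)"
  by (rule summable_comparison_test'[where g = "\<lambda>n. real n powr (- x)" and N = 0])
    (auto simp: prime_powr_def summable_real_powr_iff)

lemma prime_powr_nonneg: "prime_powr x n \<ge> 0"
  by (simp add: prime_powr_def)

lemma prime_powr_antimono: "x \<le> y \<Longrightarrow> prime_powr y n \<le> prime_powr x n"
  by (auto simp: prime_powr_def intro!: powr_mono dest: prime_ge_1_nat)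

lemma norm_log_euler_term_le:
  assumes "Re s > 1" and "norm (c n) \<le> 1"
  shows "norm (log_euler_term c s n) \<le> 2 * prime_powr (Re s) n"
proof (cases "prime n")
  case True
  have "norm (Ln (1 + - (c n * of_nat n powr (- s)))) \<le> 2 * norm (- (c n * of_nat n powr (- s)))"
    by (rule norm_Ln_le) (use norm_prime_powr_less[OF True assms] in simp)
  also have "\<dots> \<le> 2 * real n powr (- Re s)"
    using assms by (simp add: norm_mult norm_nat_powr_minus mult_left_le_one_le)
  finally show ?thesis using True by (simp add: log_euler_term_def prime_powr_def)
qed (simp add: log_euler_term_def prime_powr_def)

context
  fixes c :: "nat \<Rightarrow> complex"
  assumes norm_c: "\<And>n. norm (c n) \<le> 1"
begin

lemma log_euler_sums:
  assumes "Re s > 1"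
  shows "log_euler_term c s sums log_euler c s"
  unfolding log_euler_def
  by (rule summable_sums,
      rule summable_comparison_test'[where g = "\<lambda>n. 2 * prime_powr (Re s) n" and N = 0])
    (use norm_log_euler_term_le[of s c] norm_c assms in
     \<open>auto intro!: summable_mult summable_prime_powr\<close>)

text \<open>The bound depends only on \<open>x\<close>, so it serves all points
  \<open>2 ^ n * s\<close> of the telescoping sum at once.\<close>

lemma norm_log_euler_le:
  assumes "x > 1" and "Re s \<ge> x"
  shows "norm (log_euler c s) \<le> (\<Sum>n. 2 * prime_powr x n)"
proof -
  have "norm (log_euler_term c s n) \<le> 2 * prime_powr x n" for n
    using norm_log_euler_term_le[of s c n] norm_c[of n] prime_powr_antimono[of x "Re s" n] assms
    by simp
  then show ?thesis
    unfolding log_euler_def by (rule norm_suminf_le) (intro summable_mult summable_prime_powr assms)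
qed

text \<open>Weierstrass: each term is holomorphic, and near every point the series has a summable
  majorant.\<close>

lemma holomorphic_log_euler: "log_euler c holomorphic_on {s. Re s > 1}"
proof -
  have op: "open {s. Re s > 1}" by (rule open_halfspace_Re_gt)
  obtain g where g: "\<And>s. s \<in> {s. Re s > 1} \<Longrightarrow>
      ((\<lambda>n. log_euler_term c s n) sums g s) \<and> g field_differentiable (at s)"
  proof (rule series_differentiable_comparison_complex[OF op, of "\<lambda>n s. log_euler_term c s n"])
    fix n and s :: complex assume s: "s \<in> {s. Re s > 1}"
    show "(\<lambda>s. log_euler_term c s n) field_differentiable (at s)"
    proof (cases "prime n")
      case True
      have "norm (c n * of_nat n powr (- s)) < 1 / 2"
        using norm_prime_powr_less[OF True _ norm_c] s by simp
      then have "Re (c n * of_nat n powr (- s)) < 1"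
        \<comment> \<open>The argument of \<open>Ln\<close> has positive real part and so avoids the
          branch cut.\<close>
        using complex_Re_le_cmod[of "c n * of_nat n powr (- s)"] by linarith
      then have "1 - c n * of_nat n powr (- s) \<notin> \<real>\<^sub>\<le>\<^sub>0"
        by (auto simp: complex_nonpos_Reals_iff)
      moreover have "n \<noteq> 0" using True by (metis not_prime_0)
      ultimately have "(\<lambda>s. Ln (1 - c n * exp (- s * Ln (of_nat n)))) field_differentiable (at s)"
        unfolding field_differentiable_def
        by (intro exI) (rule derivative_eq_intros refl | simp add: powr_def)+
      moreover have "log_euler_term c s n = Ln (1 - c n * exp (- s * Ln (of_nat n)))" for s
        using True \<open>n \<noteq> 0\<close> by (simp add: log_euler_term_def powr_def)
      ultimately show ?thesis by (simp only:)
    qed (simp add: log_euler_term_def)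
  next
    fix s :: complex assume s: "s \<in> {s. Re s > 1}"
    \<comment> \<open>Halfway between 1 and \<open>Re s\<close>: on the ball of radius
      \<open>Re s - x\<close> real parts stay above \<open>x\<close>, where
      \<open>prime_powr x\<close> is still summable.\<close>
    define x where "x = (1 + Re s) / 2"
    have x: "x > 1" "x < Re s" using s by (auto simp: x_def)
    have "norm (log_euler_term c y n) \<le> norm (complex_of_real (2 * prime_powr x n))"
      if y: "y \<in> ball s (Re s - x) \<inter> {s. Re s > 1}" for y n
    proof -
      have "\<bar>Re s - Re y\<bar> < Re s - x"
        using y abs_Re_le_cmod[of "s - y"] by (auto simp: dist_norm)
      then have "prime_powr (Re y) n \<le> prime_powr x n"
        by (intro prime_powr_antimono) linarith
      then show ?thesis
        using norm_log_euler_term_le[of y c n] norm_c[of n] y prime_powr_nonneg[of x n]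
        by (simp add: norm_mult)
    qed
    then show "\<exists>d h. 0 < d \<and> summable h \<and> range h \<subseteq> \<real>\<^sub>\<ge>\<^sub>0 \<and>
        (\<forall>\<^sub>F n in sequentially. \<forall>y\<in>ball s d \<inter> {s. 1 < Re s}.
           norm (log_euler_term c y n) \<le> norm (h n :: complex))"
      using x summable_mult[OF summable_prime_powr[of x], of 2]
      by (intro exI[of _ "Re s - x"] exI[of _ "\<lambda>n. complex_of_real (2 * prime_powr x n)"])
        (auto simp: prime_powr_def simp del: of_real_mult intro!: summable_of_real always_eventually)
  qed auto
  have "log_euler c s = g s" if "Re s > 1" for s
    using g[of s] log_euler_sums[OF that] that sums_unique2 by blast
  moreover have "g holomorphic_on {s. Re s > 1}"
    unfolding holomorphic_on_def using g field_differentiable_at_within by blast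
  ultimately show ?thesis by (metis (no_types, lifting) holomorphic_transform mem_Collect_eq)
qed

text \<open>The sieve products are exponentials of the partial sums of \<open>log_euler c s\<close>,
  so the limit 1 of the sieve says that \<open>exp (log_euler c s)\<close> times the series is
  1.\<close>

lemma completely_multiplicative_series_eq_exp:
  assumes s: "Re s > 1" and c1: "c 1 = 1"
    and mult: "\<And>m n. m > 0 \<Longrightarrow> n > 0 \<Longrightarrow> c (m * n) = c m * c n"
  shows "(\<Sum>n. c (Suc n) * of_nat (Suc n) powr (- s)) = exp (- log_euler c s)"
proof -
  define f where "f n = c n * of_nat n powr (- s)" for n
  \<comment> \<open>\<open>0 powr z = 0\<close> makes \<open>f 0\<close> vanish whatever
    \<open>c 0\<close> is. Hence \<open>f\<close> is multiplicative at 0 as well, and shifting the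
    index by \<open>Suc\<close> loses nothing.\<close>
  have f_0: "f 0 = 0" and f_1: "f 1 = 1" by (simp_all add: f_def c1[simplified])
  have f_mult: "f (m * n) = f m * f n" for m n
    by (cases "m = 0 \<or> n = 0") (auto simp: f_def mult powr_times_real)
  have "norm (f n) \<le> real n powr (- Re s)" for n
    using norm_c[of n] by (simp add: f_def norm_mult norm_nat_powr_minus mult_left_le_one_le)
  then have summ: "summable (\<lambda>n. norm (f n))"
    using s by (intro summable_comparison_test[of "\<lambda>n. norm (f n)" "\<lambda>n. real n powr (- Re s)"])
      (auto simp: summable_real_powr_iff)
  have partial: "(\<Prod>n<N. if prime n then 1 - f n else 1) = exp (\<Sum>n<N. log_euler_term c s n)" for N
  proof -
    have "(if prime n then 1 - f n else 1) = exp (log_euler_term c s n)" for n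
    proof (cases "prime n")
      case True
      then have "f n \<noteq> 1" using norm_prime_powr_less[OF True s norm_c[of n]] by (auto simp: f_def)
      then show ?thesis using True by (simp add: log_euler_term_def f_def)
    qed (simp add: log_euler_term_def)
    then show ?thesis by (simp add: exp_sum)
  qed
  have "(\<lambda>N. exp (\<Sum>n<N. log_euler_term c s n) * suminf f) \<longlonglongrightarrow> exp (log_euler c s) * suminf f"
    using log_euler_sums[OF s] unfolding sums_def by (intro tendsto_intros)
  moreover have "(\<lambda>N. exp (\<Sum>n<N. log_euler_term c s n) * suminf f) \<longlonglongrightarrow> 1"
    using euler_product_sieve[OF f_mult f_1 summ] by (simp only: partial)
  ultimately have "exp (log_euler c s) * suminf f = 1" by (rule LIMSEQ_unique)
  then have "suminf f = exp (- log_euler c s)"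
    by (simp add: exp_minus inverse_unique)
  moreover have "suminf f = (\<Sum>n. f (Suc n))"
    using suminf_split_head[OF summable_norm_cancel[OF summ]] f_0 by simp
  ultimately show ?thesis by (simp add: f_def)
qed

end

section \<open>The branch of the logarithm and its telescoping sum\<close>

text \<open>Both factors lie in the right half-plane, so their arguments add up to less than
  \<open>pi\<close> in absolute value.\<close>

lemma Ln_one_minus_square:
  assumes "norm z < 1"
  shows "Ln (1 - z\<^sup>2) = Ln (1 - z) + Ln (1 + z)"
proof -
  have "\<bar>Re z\<bar> < 1" using abs_Re_le_cmod[of z] assms by simp
  then have pos: "Re (1 - z) > 0" "Re (1 + z) > 0" by auto
  then have ne: "1 - z \<noteq> 0" "1 + z \<noteq> 0" by force+
  have "\<bar>Im (Ln (1 - z))\<bar> < pi / 2" "\<bar>Im (Ln (1 + z))\<bar> < pi / 2"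
    using pos Re_Ln_pos_lt[OF ne(1)] Re_Ln_pos_lt[OF ne(2)] by blast+
  then have "Ln ((1 - z) * (1 + z)) = Ln (1 - z) + Ln (1 + z)"
    using ne by (intro Ln_times_simple) auto
  then show ?thesis by (simp add: power2_eq_square algebra_simps)
qed

definition euler_ratio_log :: "(nat \<Rightarrow> complex) \<Rightarrow> complex \<Rightarrow> complex" where
  "euler_ratio_log c s = 2 * log_euler c s - log_euler c (2 * s)"

lemma Re_power_two_mult: "Re (2 ^ n * s) = 2 ^ n * Re s"
  by (induction n) (simp_all add: mult.assoc)

lemma euler_ratio_log_telescope:
  fixes c :: "nat \<Rightarrow> complex"
  assumes c: "\<And>n. norm (c n) \<le> 1" and s: "Re s > 1"
  shows "(\<lambda>n. euler_ratio_log c (2 ^ n * s) / 2 ^ n) sums (2 * log_euler c s)"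
proof -
  \<comment> \<open>The second half of \<open>euler_ratio_log\<close> at \<open>2 ^ n * s\<close>,
    divided by \<open>2 ^ n\<close>, is \<open>F (Suc n)\<close>: the doubled argument uses up the
    factor 2 of \<open>F\<close>.\<close>
  define F where "F n = 2 * log_euler c (2 ^ n * s) / 2 ^ n" for n
  define M where "M = (\<Sum>n. 2 * prime_powr (Re s) n)"
  have "norm (F n) \<le> 2 * M * (1 / 2) ^ n" for n
  proof -
    have "1 * Re s \<le> 2 ^ n * Re s"
      using s by (intro mult_right_mono) auto
    then have "norm (log_euler c (2 ^ n * s)) \<le> M"
      unfolding M_def using s by (intro norm_log_euler_le c) (auto simp: Re_power_two_mult)
    then show ?thesis
      by (simp add: F_def norm_divide norm_mult norm_power power_divide field_simps)
  qed
  moreover have "(\<lambda>n. 2 * M * (1 / 2) ^ n) \<longlonglongrightarrow> 0"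
    by (intro tendsto_mult_right_zero LIMSEQ_power_zero) auto
  ultimately have "F \<longlonglongrightarrow> 0"
    by (intro Lim_null_comparison[of F "\<lambda>n. 2 * M * (1 / 2) ^ n"] always_eventually) auto
  then have "(\<lambda>n. F n - F (Suc n)) sums (F 0 - 0)" by (rule telescope_sums')
  moreover have "F n - F (Suc n) = euler_ratio_log c (2 ^ n * s) / 2 ^ n" for n
    by (simp add: F_def euler_ratio_log_def diff_divide_distrib mult.assoc)
  ultimately show ?thesis by (simp add: F_def)
qed

lemma holomorphic_euler_ratio_log:
  assumes "\<And>n. norm (c n) \<le> 1"
  shows "euler_ratio_log c holomorphic_on {s. Re s > 1}"
proof -
  have "(log_euler c \<circ> (\<lambda>s. 2 * s)) holomorphic_on {s. Re s > 1}"
    by (rule holomorphic_on_compose_gen[OF _ holomorphic_log_euler[OF assms]])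
      (auto intro!: holomorphic_intros)
  then show ?thesis
    using holomorphic_log_euler[OF assms]
    by (auto simp: euler_ratio_log_def[abs_def] o_def intro!: holomorphic_intros)
qed

text \<open>With \<open>z = n powr (- s)\<close>, the term
  \<open>2 Ln (1 - z) - Ln (1 - z\<^sup>2)\<close> collapses to
  \<open>Ln (1 - z) - Ln (1 + z)\<close>. For 0-1 coefficients both series run over the same
  primes.\<close>

lemma euler_ratio_log_sums:
  assumes c: "\<And>n. c n \<in> {0, 1}" and s: "Re s > 1"
  shows "(\<lambda>n. if prime n \<and> c n = 1
            then Ln (1 - of_nat n powr (- s)) - Ln (1 + of_nat n powr (- s)) else 0)
         sums euler_ratio_log c s"
proof -
  have norm_c: "norm (c n) \<le> 1" for n using c[of n] by auto
  have "(\<lambda>n. 2 * log_euler_term c s n - log_euler_term c (2 * s) n) sums euler_ratio_log c s"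
    unfolding euler_ratio_log_def
    using s by (intro sums_diff sums_mult log_euler_sums norm_c) auto
  moreover have "2 * log_euler_term c s n - log_euler_term c (2 * s) n =
      (if prime n \<and> c n = 1
       then Ln (1 - of_nat n powr (- s)) - Ln (1 + of_nat n powr (- s)) else 0)" for n
  proof (cases "prime n \<and> c n = 1")
    case True
    have "norm (of_nat n powr (- s)) < 1"
      using norm_prime_powr_less[of n s 1] True s by simp
    then have "Ln (1 - of_nat n powr (- (2 * s))) =
        Ln (1 - of_nat n powr (- s)) + Ln (1 + of_nat n powr (- s))"
      using Ln_one_minus_square by (simp only: flip: nat_powr_minus_square)
    then show ?thesis using True by (simp add: log_euler_term_def)
  next
    case False
    then show ?thesis using c[of n] by (auto simp: log_euler_term_def)
  qed
  ultimately show ?thesis by simp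
qed

lemma norm_euler_ratio_log_less_pi:
  assumes c: "\<And>n. c n \<in> {0, 1}" and s: "Re s \<ge> 2"
  shows "norm (euler_ratio_log c s) < pi"
proof -
  let ?z = "\<lambda>n. of_nat n powr (- s) :: complex"
  define t where "t n = (if prime n \<and> c n = 1 then Ln (1 - ?z n) - Ln (1 + ?z n) else 0)" for n
  have t: "t sums euler_ratio_log c s"
    unfolding t_def using s by (intro euler_ratio_log_sums c) auto
  have t_le: "norm (t n) \<le> (if n \<ge> 2 then 4 * (1 / real n ^ 2) else 0)" for n
  proof (cases "prime n \<and> c n = 1")
    case True
    have z: "norm (?z n) < 1 / 2" using norm_prime_powr_less[of n s 1] True s by simp
    have "norm (Ln (1 + - ?z n)) \<le> 2 * norm (- ?z n)" "norm (Ln (1 + ?z n)) \<le> 2 * norm (?z n)"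
      using z by (intro norm_Ln_le; simp)+
    then have "norm (t n) \<le> 4 * norm (?z n)"
      using True norm_triangle_ineq4[of "Ln (1 - ?z n)" "Ln (1 + ?z n)"] by (simp add: t_def)
    also have "norm (?z n) \<le> real n powr (- 2)"
      unfolding norm_nat_powr_minus using s True prime_ge_1_nat[of n] by (intro powr_mono) auto
    also have "real n powr (- 2) = 1 / real n ^ 2"
      using True by (simp add: powr_minus divide_inverse prime_gt_0_nat)
    finally show ?thesis using True prime_ge_2_nat by auto
  qed (auto simp: t_def)
  have "(\<lambda>n. 1 / real (n + 1) ^ 2) sums (pi\<^sup>2 / 6)"
    using inverse_squares_sums by (simp add: add.commute)
  \<comment> \<open>Dropping the term 1 from the Basel sum leaves the sum over
    \<open>n \<ge> 2\<close>, which contains all primes.\<close>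
  then have "(\<lambda>n. 1 / real (n + 2) ^ 2) sums (pi\<^sup>2 / 6 - 1)"
    using sums_Suc_iff[of "\<lambda>n. 1 / real (n + 1) ^ 2" "pi\<^sup>2 / 6 - 1"] by simp
  then have "(\<lambda>n. 4 * (1 / real (n + 2) ^ 2)) sums (4 * (pi\<^sup>2 / 6 - 1))"
    by (rule sums_mult)
  then have "(\<lambda>n. if n \<ge> 2 then 4 * (1 / real n ^ 2) else 0) sums (4 * (pi\<^sup>2 / 6 - 1))"
    using sums_iff_shift[of "\<lambda>n. if n \<ge> 2 then 4 * (1 / real n ^ 2) else 0" 2 "4 * (pi\<^sup>2 / 6 - 1)"]
    by (simp add: lessThan_nat_numeral)
  then have "norm (euler_ratio_log c s) \<le> 4 * (pi\<^sup>2 / 6 - 1)"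
    using norm_sums_le[OF t _ t_le] by blast
  also have "\<dots> < pi"
  proof -
    \<comment> \<open>From \<open>pi < 3.2\<close> the bound is below
      \<open>4 * (10.24 / 6 - 1)\<close>, about 2.83, hence below 3.\<close>
    have "pi < 16 / 5" using pi_approx by simp
    then have "pi\<^sup>2 < (16 / 5)\<^sup>2" by (intro power_strict_mono) auto
    then have "pi\<^sup>2 < 256 / 25" by (simp add: power_divide)
    with pi_gt3 show ?thesis by simp
  qed
  finally show ?thesis .
qed

text \<open>On the real ray every logarithm is that of a positive real. This yields agreement with
  \<open>Ln\<close> there, as \<open>log_branch\<close> demands.\<close>

lemma Im_euler_ratio_log_of_real:
  assumes c: "\<And>n. c n \<in> {0, 1}" and x: "x > 1"
  shows "Im (euler_ratio_log c (of_real x)) = 0"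
proof -
  have "Im (if prime n \<and> c n = 1 then Ln (1 - of_nat n powr (- of_real x)) -
      Ln (1 + of_nat n powr (- of_real x)) else 0) = 0" for n
  proof (cases "prime n")
    case True
    let ?r = "real n powr (- x)"
    have r: "(of_nat n powr (- of_real x) :: complex) = of_real ?r"
      by (metis of_nat_0_le_iff of_real_minus of_real_of_nat_eq powr_of_real)
    have "norm (of_nat n powr (- of_real x) :: complex) < 1 / 2"
      using norm_prime_powr_less[of n "of_real x" 1] True x by simp
    then have "\<bar>?r\<bar> < 1 / 2" unfolding r norm_of_real .
    then have "0 < 1 - ?r" "0 < 1 + ?r" by linarith+
    then have "Im (Ln (of_real (1 - ?r))) = 0" "Im (Ln (of_real (1 + ?r))) = 0"
      by (simp_all only: Ln_of_real Im_complex_of_real)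
    then show ?thesis unfolding r by simp
  qed simp
  moreover have "(\<lambda>n. Im (if prime n \<and> c n = 1 then Ln (1 - of_nat n powr (- of_real x)) -
      Ln (1 + of_nat n powr (- of_real x)) else 0)) sums Im (euler_ratio_log c (of_real x))"
    by (intro sums_Im euler_ratio_log_sums c) (use x in simp)
  ultimately have "(\<lambda>n. 0) sums Im (euler_ratio_log c (of_real x))" by (simp only:)
  then show ?thesis using sums_unique2 sums_zero by blast
qed

lemma log_branch_formula:
  fixes P Q :: "complex \<Rightarrow> complex"
  assumes c: "\<And>n. c n \<in> {0, 1}"
    and P: "\<And>s. Re s > 1 \<Longrightarrow> P s = exp (- log_euler c s)"
    and Q: "\<And>s. Re s > 1 \<Longrightarrow> Q s = exp (euler_ratio_log c s)"
  shows "\<exists>l. log_branch Q l \<and>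
           (\<forall>s. Re s > 1 \<longrightarrow> P s = exp (- (1 / 2) * (\<Sum>n. l (2 ^ n * s) / 2 ^ n))) \<and>
           (\<forall>s. Re s > 1 \<and> l s = Ln (Q s) \<longrightarrow>
              P s = exp (- (1 / 2) * (\<Sum>n. Ln (Q (2 ^ n * s)) / 2 ^ n))) \<and>
           (\<forall>s. Re s \<ge> 2 \<longrightarrow> l s = Ln (Q s))"
proof (intro exI[of _ "euler_ratio_log c"] conjI allI impI)
  have norm_c: "norm (c n) \<le> 1" for n using c[of n] by auto
  have Ln_Q: "euler_ratio_log c s = Ln (Q s)"
    if "Re s > 1" "\<bar>Im (euler_ratio_log c s)\<bar> < pi" for s
    using that by (simp add: Q Ln_exp)
  show principal: "euler_ratio_log c s = Ln (Q s)" if "Re s \<ge> 2" for s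
    using that norm_euler_ratio_log_less_pi[of c s, OF c that] abs_Im_le_cmod[of "euler_ratio_log c s"]
    by (intro Ln_Q) auto
  show "log_branch Q (euler_ratio_log c)"
    unfolding log_branch_def
    using holomorphic_euler_ratio_log[OF norm_c] Q Ln_Q Im_euler_ratio_log_of_real[OF c] by auto
  show formula: "P s = exp (- (1 / 2) * (\<Sum>n. euler_ratio_log c (2 ^ n * s) / 2 ^ n))"
    if "Re s > 1" for s
    using euler_ratio_log_telescope[of c s, OF norm_c that] by (simp add: P that flip: sums_unique)
  fix s assume s: "Re s > 1 \<and> euler_ratio_log c s = Ln (Q s)"
  \<comment> \<open>Only \<open>n = 0\<close> needs the assumption on \<open>s\<close>; for later
    \<open>n\<close> the real part is at least 2 and the branch is principal.\<close>
  have "euler_ratio_log c (2 ^ n * s) = Ln (Q (2 ^ n * s))" for n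
  proof (cases n)
    case (Suc m)
    have "2 * 1 \<le> 2 ^ n * Re s"
      using s Suc by (intro mult_mono) auto
    then show ?thesis by (intro principal) (simp add: Re_power_two_mult)
  qed (use s in simp)
  then show "P s = exp (- (1 / 2) * (\<Sum>n. Ln (Q (2 ^ n * s)) / 2 ^ n))"
    using formula s by simp
qed

section \<open>Exponential forms of the prime products, \<open>zeta\<close>,
  \<open>dirichlet_L\<close> and the quotients\<close>

lemma prime_product_eq_exp:
  assumes s: "Re s > 1"
  shows "prime_product A (\<lambda>n. inverse (1 - of_nat n powr (- s))) =
         exp (- log_euler (\<lambda>n. of_bool (A n)) s)"
proof -
  let ?c = "\<lambda>n. of_bool (A n) :: complex"
  have "norm (?c n) \<le> 1" for n by simp
  note sums = log_euler_sums[OF this s]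
  have "(if prime n \<and> A n then inverse (1 - of_nat n powr (- s)) else 1) =
      exp (- log_euler_term ?c s n)" for n
  proof (cases "prime n \<and> A n")
    case True
    \<comment> \<open>This keeps \<open>1 - z\<close> away from 0, where \<open>exp\<close> would
      not invert \<open>Ln\<close>.\<close>
    then have "of_nat n powr (- s) \<noteq> (1 :: complex)"
      using norm_prime_powr_less[of n s 1] s by auto
    then show ?thesis using True by (simp add: log_euler_term_def exp_minus)
  qed (auto simp: log_euler_term_def)
  then have "prime_product A (\<lambda>n. inverse (1 - of_nat n powr (- s))) =
      prodinf (\<lambda>n. exp (- log_euler_term ?c s n))"
    by (simp add: prime_product_def)
  also have "\<dots> = exp (\<Sum>n. - log_euler_term ?c s n)"
    by (rule prodinf_exp) (use sums in \<open>simp add: sums_iff summable_minus\<close>)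
  finally show ?thesis
    using sums by (simp add: sums_iff suminf_minus)
qed

lemma zeta_eq_exp: "Re s > 1 \<Longrightarrow> zeta s = exp (- log_euler (\<lambda>n. 1) s)"
  using completely_multiplicative_series_eq_exp[of "\<lambda>n. 1" s] by (simp add: zeta_def)

lemma kronecker_prime_range: "kronecker_prime a p \<in> {- 1, 0, 1}"
  by (simp add: kronecker_prime_def Legendre_def)

lemma abs_kronecker_le_1: "\<bar>kronecker a n\<bar> \<le> 1"
proof (cases "n = 0")
  case False
  have "\<bar>\<Prod>p\<in>#M. kronecker_prime a p\<bar> \<le> 1" for M
  proof (induction M)
    case (add p M)
    then show ?case
      using kronecker_prime_range[of a p] by (auto simp: abs_mult)
  qed simp
  then show ?thesis using False by (simp add: kronecker_def)
qed (simp add: kronecker_def)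

lemma kronecker_mult: "m > 0 \<Longrightarrow> n > 0 \<Longrightarrow> kronecker a (m * n) = kronecker a m * kronecker a n"
  by (simp add: kronecker_def prime_factorization_mult)

lemma kronecker_of_prime: "prime p \<Longrightarrow> kronecker a p = kronecker_prime a p"
  by (auto simp: kronecker_def prime_factorization_prime)

text \<open>Matches the finite correction products over \<open>p | d\<close> with the primes that
  belong to neither \<open>p\<^sub>1\<close> nor \<open>p\<^sub>2\<close>.\<close>

lemma kronecker_prime_eq_0_iff:
  "prime p \<Longrightarrow> kronecker_prime a p = 0 \<longleftrightarrow> p dvd nat \<bar>a\<bar>"
  by (auto simp: kronecker_prime_def Legendre_def cong_0_iff nat_dvd_iff dvd_nat_abs_iff)

lemma dirichlet_L_kronecker_eq_exp:
  assumes "Re s > 1"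
  shows "dirichlet_L (kronecker a) s = exp (- log_euler (\<lambda>n. of_int (kronecker a n)) s)"
proof -
  have "norm (of_int (kronecker a n) :: complex) \<le> 1" for n
    using abs_kronecker_le_1[of a n] by (simp flip: of_int_abs)
  moreover have "kronecker a 1 = 1" by (simp add: kronecker_def)
  ultimately show ?thesis
    using completely_multiplicative_series_eq_exp[of "\<lambda>n. of_int (kronecker a n)" s] assms
    by (simp add: dirichlet_L_def kronecker_mult)
qed

lemma euler_quotients_eq_exp:
  assumes s: "Re s > 1" and "a \<noteq> 0"
  shows "zeta (2 * s) / (zeta s * dirichlet_L (kronecker a) s) *
           (\<Prod>r\<in>{r. prime r \<and> r dvd nat \<bar>a\<bar>}. 1 + of_nat r powr (- s)) =
         exp (euler_ratio_log (\<lambda>n. of_bool (kronecker a n = 1)) s)"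
    (is "_ * (\<Prod>r\<in>?D. _) = exp (euler_ratio_log ?c s)")
    and "dirichlet_L (kronecker a) s / zeta s *
           (\<Prod>r\<in>{r. prime r \<and> r dvd nat \<bar>a\<bar>}. inverse (1 - of_nat r powr (- s))) =
         exp (euler_ratio_log (\<lambda>n. of_bool (kronecker a n = - 1)) s)"
    (is "_ = exp (euler_ratio_log ?c' s)")
proof -
  let ?chi = "\<lambda>n. of_int (kronecker a n) :: complex"
  let ?z = "\<lambda>n. of_nat n powr (- s) :: complex"
  \<comment> \<open>For \<open>a = 0\<close> every prime would lie in \<open>?D\<close>.\<close>
  have fin: "finite ?D"
    using assms(2) by (intro finite_subset[OF _ finite_divisors_nat[of "nat \<bar>a\<bar>"]]) auto
  have s2: "Re (2 * s) > 1" using s by simp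
  have norm_chi: "norm (?chi n) \<le> 1" for n
    using abs_kronecker_le_1[of a n] by (simp flip: of_int_abs)
  have norm_one: "norm (1 :: complex) \<le> 1" by simp
  have z: "norm (?z n) < 1" if "prime n" for n
    using norm_prime_powr_less[OF that s norm_one] by simp
  have z_ne: "1 - ?z n \<noteq> 0" "1 + ?z n \<noteq> 0" if "prime n" for n
    using z[OF that] by (auto simp: add_eq_0_iff)
  have square: "Ln (1 - of_nat n powr (- (2 * s))) = Ln (1 - ?z n) + Ln (1 + ?z n)" if "prime n" for n
    using Ln_one_minus_square[OF z[OF that]] by (simp only: nat_powr_minus_square)
  have chi_values: "kronecker a n \<in> {- 1, 0, 1}" "n \<in> ?D \<longleftrightarrow> kronecker a n = 0" if "prime n" for n
    using that kronecker_prime_range[of a n] kronecker_prime_eq_0_iff[of n a]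
    by (auto simp: kronecker_of_prime)
  have c01: "?c n \<in> {0, 1}" "?c' n \<in> {0, 1}" for n by auto
  note sums1 = log_euler_sums[OF norm_one s] and sums2 = log_euler_sums[OF norm_one s2]
    and sums_chi = log_euler_sums[OF norm_chi s]

  have plus: "(\<Prod>r\<in>?D. 1 + ?z r) = exp (\<Sum>r\<in>?D. Ln (1 + ?z r))"
    using fin z_ne by (subst exp_sum) (auto intro!: prod.cong)
  have "(\<lambda>n. - log_euler_term (\<lambda>n. 1) (2 * s) n - (- log_euler_term (\<lambda>n. 1) s n) -
      (- log_euler_term ?chi s n) + (if n \<in> ?D then Ln (1 + ?z n) else 0)) sums
      (- log_euler (\<lambda>n. 1) (2 * s) - (- log_euler (\<lambda>n. 1) s) - (- log_euler ?chi s) +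
      (\<Sum>r\<in>?D. Ln (1 + ?z r)))"
    by (intro sums_add sums_diff sums_minus sums1 sums2 sums_chi sums_If_finite_set fin)
  \<comment> \<open>For a prime, \<open>square\<close> reduces the left side to
    \<open>Ln (1 - chi z) - Ln (1 + z)\<close>, plus \<open>Ln (1 + z)\<close> if
    \<open>chi = 0\<close>. It vanishes unless \<open>chi = 1\<close>.\<close>
  moreover have "- log_euler_term (\<lambda>n. 1) (2 * s) n - (- log_euler_term (\<lambda>n. 1) s n) -
      (- log_euler_term ?chi s n) + (if n \<in> ?D then Ln (1 + ?z n) else 0) =
      (if prime n \<and> ?c n = 1 then Ln (1 - ?z n) - Ln (1 + ?z n) else 0)" for n
  proof (cases "prime n")
    case True
    then show ?thesis
      using chi_values[OF True] square[OF True] by (auto simp: log_euler_term_def simp del: mem_Collect_eq)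
  qed (simp add: log_euler_term_def)
  ultimately have "euler_ratio_log ?c s = - log_euler (\<lambda>n. 1) (2 * s) - (- log_euler (\<lambda>n. 1) s) -
      (- log_euler ?chi s) + (\<Sum>r\<in>?D. Ln (1 + ?z r))"
    by - (rule sums_unique2[OF euler_ratio_log_sums[of ?c s, OF c01(1) s]], simp only:)
  then show "zeta (2 * s) / (zeta s * dirichlet_L (kronecker a) s) * (\<Prod>r\<in>?D. 1 + ?z r) =
      exp (euler_ratio_log ?c s)"
    by (simp only: zeta_eq_exp[OF s] zeta_eq_exp[OF s2] dirichlet_L_kronecker_eq_exp[OF s] plus
        exp_add exp_diff divide_divide_eq_left)

  have minus: "(\<Prod>r\<in>?D. inverse (1 - ?z r)) = exp (\<Sum>r\<in>?D. - Ln (1 - ?z r))"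
    using fin z_ne by (subst exp_sum) (auto intro!: prod.cong simp: exp_minus)
  have "(\<lambda>n. - log_euler_term ?chi s n - (- log_euler_term (\<lambda>n. 1) s n) +
      (if n \<in> ?D then - Ln (1 - ?z n) else 0)) sums
      (- log_euler ?chi s - (- log_euler (\<lambda>n. 1) s) + (\<Sum>r\<in>?D. - Ln (1 - ?z r)))"
    by (intro sums_add sums_diff sums_minus sums1 sums_chi sums_If_finite_set fin)
  \<comment> \<open>Here a prime contributes \<open>Ln (1 - z) - Ln (1 - chi z)\<close>, minus
    \<open>Ln (1 - z)\<close> if \<open>chi = 0\<close>. It vanishes unless
    \<open>chi = - 1\<close>.\<close>
  moreover have "- log_euler_term ?chi s n - (- log_euler_term (\<lambda>n. 1) s n) +
      (if n \<in> ?D then - Ln (1 - ?z n) else 0) =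
      (if prime n \<and> ?c' n = 1 then Ln (1 - ?z n) - Ln (1 + ?z n) else 0)" for n
  proof (cases "prime n")
    case True
    then show ?thesis
      using chi_values[OF True] by (auto simp: log_euler_term_def simp del: mem_Collect_eq)
  qed (simp add: log_euler_term_def)
  ultimately have "euler_ratio_log ?c' s =
      - log_euler ?chi s - (- log_euler (\<lambda>n. 1) s) + (\<Sum>r\<in>?D. - Ln (1 - ?z r))"
    by - (rule sums_unique2[OF euler_ratio_log_sums[of ?c' s, OF c01(2) s]], simp only:)
  then show "dirichlet_L (kronecker a) s / zeta s * (\<Prod>r\<in>?D. inverse (1 - ?z r)) =
      exp (euler_ratio_log ?c' s)"
    by (simp only: zeta_eq_exp[OF s] dirichlet_L_kronecker_eq_exp[OF s] minus exp_add exp_diff)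
qed

text \<open>The identity holds on the whole half-plane for the continued branch \<open>l\<close>.
  The last two clauses recover it with principal logarithms wherever
  \<open>l s = Ln (q i s)\<close>, in particular for \<open>Re s \<ge> 2\<close>.\<close>

theorem corollary4:
  fixes K :: "complex set" and \<Delta> :: int and d :: nat and chi :: "nat \<Rightarrow> int"
    and p q :: "nat \<Rightarrow> complex \<Rightarrow> complex"
  assumes "quadratic_field K" and "has_discriminant K \<Delta>"
    and "d = nat \<bar>\<Delta>\<bar>" and "chi = kronecker \<Delta>"
    and "\<And>s. Re s > 1 \<Longrightarrow>
           p 1 s = prime_product (\<lambda>r. chi r = 1) (\<lambda>r. inverse (1 - of_nat r powr (- s)))"
    and "\<And>s. Re s > 1 \<Longrightarrow>
           p 2 s = prime_product (\<lambda>r. chi r = - 1) (\<lambda>r. inverse (1 - of_nat r powr (- s)))"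
    and "\<And>s. Re s > 1 \<Longrightarrow>
           q 1 s = zeta (2 * s) / (zeta s * dirichlet_L chi s) *
             (\<Prod>r\<in>{r. prime r \<and> r dvd d}. 1 + of_nat r powr (- s))"
    and "\<And>s. Re s > 1 \<Longrightarrow>
           q 2 s = dirichlet_L chi s / zeta s *
             (\<Prod>r\<in>{r. prime r \<and> r dvd d}. inverse (1 - of_nat r powr (- s)))"
  shows "\<forall>i\<in>{1, 2}. \<exists>l. log_branch (q i) l \<and>
           (\<forall>s. Re s > 1 \<longrightarrow>
              p i s = exp (- (1 / 2) * (\<Sum>n. l (2 ^ n * s) / 2 ^ n))) \<and>
           (\<forall>s. Re s > 1 \<and> l s = Ln (q i s) \<longrightarrow>
              p i s = exp (- (1 / 2) * (\<Sum>n. Ln (q i (2 ^ n * s)) / 2 ^ n))) \<and>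
           (\<forall>s. Re s \<ge> 2 \<longrightarrow> l s = Ln (q i s))"
proof -
  have "\<Delta> \<noteq> 0" using assms(1,2) by (rule discriminant_nonzero)
  note q_exp = euler_quotients_eq_exp[OF _ this]
  have "\<exists>l. log_branch (q i) l \<and>
      (\<forall>s. Re s > 1 \<longrightarrow> p i s = exp (- (1 / 2) * (\<Sum>n. l (2 ^ n * s) / 2 ^ n))) \<and>
      (\<forall>s. Re s > 1 \<and> l s = Ln (q i s) \<longrightarrow>
         p i s = exp (- (1 / 2) * (\<Sum>n. Ln (q i (2 ^ n * s)) / 2 ^ n))) \<and>
      (\<forall>s. Re s \<ge> 2 \<longrightarrow> l s = Ln (q i s))" if i: "i = 1 \<or> i = 2" for i
  \<comment> \<open>The indicator of the split primes for \<open>i = 1\<close> and of the inert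
    primes for \<open>i = 2\<close>.\<close>
  proof (rule log_branch_formula[where c = "\<lambda>n. of_bool (chi n = (if i = 1 then 1 else - 1))"])
    fix s :: complex assume s: "Re s > 1"
    show "p i s = exp (- log_euler (\<lambda>n. of_bool (chi n = (if i = 1 then 1 else - 1))) s)"
      using i assms(5,6)[OF s] prime_product_eq_exp[OF s] by auto
    show "q i s = exp (euler_ratio_log (\<lambda>n. of_bool (chi n = (if i = 1 then 1 else - 1))) s)"
      using i assms(7,8)[OF s] q_exp[OF s] by (auto simp: assms(3,4))
  qed auto
  then show ?thesis by blast
qed

end
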